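(* Let $n\ge1$ and $k\ge1$ be integers with $k\le n/2$, and let $\mathcal{M}(n,k)$ denote the minimum cardinality of a $(k,k)$-design in $F_2^n$. Then \[ \mathcal{M}(n,k)\ \ge\ \sum_{i=0}^k\binom{n-1}{i}. \] Moreover, if a $(k,k)$-design $C\subseteq F_2^n$ attains this bound, then for all distinct $x,y\in C$ the number $\langle x,y\rangle$ is a zero of $Q_k^{1,1}(t)$, and $|C|=\sum_{i=0}^k\binom{n-1}{i}$ is divisible by $2^{2k}$.
   Context: $F_2^n$ is the set of binary vectors of length $n$, with Hamming distance $d(x,y)$, and $\langle x,y\rangle:=1-\frac{2d(x,y)}{n}$. The Krawtchouk polynomials $Q_i^{(n)}(t)$ are defined by $Q_0^{(n)}=1$, $Q_1^{(n)}(t)=t$, $ntQ_i^{(n)}(t)=(n-i)Q_{i+1}^{(n)}(t)+iQ_{i-1}^{(n)}(t)$ for $1\le i\le n-1$. For a nonempty $C\subseteq F_2^n$ the moments are $M_i(C):=\sum_{x,y\in C}Q_i^{(n)}(\langle x,y\rangle)$ (over all ordered pairs, including $x=y$). $C$ is a $(k,k)$-design if $M_i(C)=0$ for $i=2,4,\dots,2k$. The $(1,1)$-adjacent polynomial $Q_k^{1,1}(t)$ (for $0\le k\le n-2$) is \[ Q_k^{1,1}(t)=\frac{K_k^{(n-2)}(z-1)}{\sum_{j=0}^k\binom{n-1}{j}},\qquad z=\frac{n(1-t)}{2},\] where $K_k^{(N)}(z)=\sum_{j=0}^k(-1)^j\binom{z}{j}\binom{N-z}{k-j}$ is the binary Krawtchouk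 polynomial (as a polynomial in $z$). E.g. $Q_1^{1,1}(t)=t$, $Q_2^{1,1}(t)=\frac{n^2t^2-n+2}{n^2-n+2}$, $Q_3^{1,1}(t)=\frac{n^2t^3-(n-8)t}{n^2-n+8}$.
   Formalization: The divisibility of |C| by 2^{2k} is claimed only for k ≤ n−2, which excludes just n=2, k=1; there it fails: C={00,01} is a (1,1)-design attaining the bound with |C|=2, not divisible by 4. *)

theory Defs
  imports Complex_Main "HOL-Library.Z2"
begin

definition F2 :: "nat \<Rightarrow> bit list set" where
  "F2 n = {x. length x = n}"

definition hamming :: "bit list \<Rightarrow> bit list \<Rightarrow> nat" where
  "hamming x y = card {i. i < length x \<and> x ! i \<noteq> y ! i}"

definition ip :: "nat \<Rightarrow> bit list \<Rightarrow> bit list \<Rightarrow> real" where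
  "ip n x y = 1 - 2 * real (hamming x y) / real n"

text \<open>The recurrence \<open>n t Q\<^sub>i = (n - i) Q\<^sub>i\<^sub>+\<^sub>1 + i Q\<^sub>i\<^sub>-\<^sub>1\<close> is solved for the term of
  highest index, so the values are meaningful for indices up to \<open>n\<close> only.\<close>

fun krawtchouk_Q :: "nat \<Rightarrow> nat \<Rightarrow> real \<Rightarrow> real" where
  "krawtchouk_Q n 0 t = 1"
| "krawtchouk_Q n (Suc 0) t = t"
| "krawtchouk_Q n (Suc (Suc i)) t =
     (real n * t * krawtchouk_Q n (Suc i) t - real (Suc i) * krawtchouk_Q n i t)
       / (real n - real (Suc i))"

definition moment :: "nat \<Rightarrow> nat \<Rightarrow> bit list set \<Rightarrow> real" where
  "moment n i C = (\<Sum>x\<in>C. \<Sum>y\<in>C. krawtchouk_Q n i (ip n x y))"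

definition kk_design :: "nat \<Rightarrow> nat \<Rightarrow> bit list set \<Rightarrow> bool" where
  "kk_design n k C \<longleftrightarrow>
     C \<subseteq> F2 n \<and> C \<noteq> {} \<and> (\<forall>j\<in>{1..k}. moment n (2 * j) C = 0)"

text \<open>The infimum is taken in \<^typ>\<open>nat\<close>, hence it is a minimum if some design exists and \<open>0\<close>
  otherwise. A positive lower bound on it therefore also says that designs exist.\<close>

definition min_design_card :: "nat \<Rightarrow> nat \<Rightarrow> nat" where
  "min_design_card n k = Inf {card C |C. kk_design n k C}"

definition krawtchouk_K :: "nat \<Rightarrow> nat \<Rightarrow> real \<Rightarrow> real" where
  "krawtchouk_K N k z = (\<Sum>j\<le>k. (-1) ^ j * (z gchoose j) * ((real N - z) gchoose (k - j)))"

text \<open>The polynomial is usually defined for \<open>k \<le> n - 2\<close>. The formula itself makes sense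
  for all \<open>n \<ge> 2\<close>, and for \<open>n = 2\<close>, \<open>k = 1\<close> it gives \<open>t\<close>.\<close>

definition adjacent_Q11 :: "nat \<Rightarrow> nat \<Rightarrow> real \<Rightarrow> real" where
  "adjacent_Q11 n k t =
     krawtchouk_K (n - 2) k (real n * (1 - t) / 2 - 1) / (\<Sum>j\<le>k. real ((n - 1) choose j))"

end

(* A character of F_2^n indexed by an even set is a character of the quotient by the all-one word,
   which is F_2^(n-1) after normalising one coordinate. The moments are sums of squares of character
   sums, so a (k,k)-design is the same as a multiset in F_2^(n-1) whose character sums over all
   nonempty sets of size at most 2k vanish: an orthogonal array of strength 2k. The bound is then
   Rao's bound. It follows from the kernel R(x,y), the sum of psi_S(x) psi_S(y) over |S| <= k,
   which satisfies R(x,x) = |U| and sum_y R(x,y)^2 = |U| |C| with U the set of all such S. In the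
   equality case R(x,y) = 0 for x ~= y, and R is a partial sum of Krawtchouk polynomials, hence again
   a Krawtchouk polynomial. The divisibility holds since a subcube pattern on 2k coordinates
   occurs equally often in an orthogonal array of strength 2k. *)
theory Submission
  imports Defs "HOL-Computational_Algebra.Polynomial"
begin

section \<open>The generating polynomial of the Krawtchouk polynomials\<close>

text \<open>The polynomial \<open>(1 - X)^m * (1 + X)^r\<close> generates, by degree, the Krawtchouk
  values of length \<open>m + r\<close> at \<open>m\<close>. Here \<open>m\<close> counts the
  coordinates where two words differ and \<open>r\<close> those where they agree.\<close>

definition kraw_gen :: "nat \<Rightarrow> nat \<Rightarrow> real poly" where
  "kraw_gen m r = [:1, -1:] ^ m * [:1, 1:] ^ r"

text \<open>Taking the linear term in exactly \<open>i\<close> factors gives the elementary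
  symmetric function of degree \<open>i\<close>.\<close>

lemma coeff_prod_linear:
  fixes f :: "'a \<Rightarrow> 'b :: comm_ring_1"
  assumes "finite A"
  shows "coeff (\<Prod>a\<in>A. [:1, f a:]) i = (\<Sum>S | S \<subseteq> A \<and> card S = i. \<Prod>a\<in>S. f a)"
proof -
  have monom: "(\<Prod>a\<in>S. monom (f a) 1) = monom (\<Prod>a\<in>S. f a) (card S)" if "finite S" for S
    using that by (induction S) (simp_all add: mult_monom)
  have "(\<Prod>a\<in>A. [:1, f a:]) = (\<Prod>a\<in>A. monom (f a) 1 + 1)"
    by (intro prod.cong) (simp_all add: monom_altdef one_pCons)
  also have "\<dots> = (\<Sum>S\<in>Pow A. (\<Prod>a\<in>S. monom (f a) 1))"
    using prod_add[OF assms, of "\<lambda>a. monom (f a) 1" "\<lambda>_. 1"] by simp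
  also have "\<dots> = (\<Sum>S\<in>Pow A. monom (\<Prod>a\<in>S. f a) (card S))"
    using assms by (intro sum.cong refl monom) (auto intro: finite_subset)
  finally have "coeff (\<Prod>a\<in>A. [:1, f a:]) i
      = (\<Sum>S\<in>Pow A. if card S = i then \<Prod>a\<in>S. f a else 0)"
    by (simp add: coeff_sum)
  also have "\<dots> = (\<Sum>S | S \<subseteq> A \<and> card S = i. \<Prod>a\<in>S. f a)"
    using assms by (intro sum.mono_neutral_cong_right) auto
  finally show ?thesis .
qed

lemma kraw_gen_eq_prod:
  assumes "finite A" and "D \<subseteq> A"
  shows "kraw_gen (card D) (card A - card D) = (\<Prod>a\<in>A. [:1, if a \<in> D then -1 else 1:])"
proof -
  have "finite D" using assms by (rule finite_subset[rotated])
  then have D: "finite D" "card (A - D) = card A - card D"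
    using assms by (simp_all add: card_Diff_subset)
  have "(\<Prod>a\<in>A. [:1, if a \<in> D then -1 else 1 :: real:])
      = (\<Prod>a\<in>A - D. [:1, if a \<in> D then -1 else 1:]) * (\<Prod>a\<in>D. [:1, if a \<in> D then -1 else 1:])"
    using assms by (intro prod.subset_diff)
  also have "\<dots> = (\<Prod>a\<in>A - D. [:1, 1:]) * (\<Prod>a\<in>D. [:1, -1:])"
    by (intro arg_cong2[of _ _ _ _ "(*)"] prod.cong) auto
  finally show ?thesis using D by (simp add: kraw_gen_def)
qed

text \<open>The link from characters to Krawtchouk values: summed over all index sets of size
  \<open>i\<close>, a product of signs depends only on how many signs are negative.\<close>

lemma coeff_kraw_gen_eq_sum:
  assumes "finite A" and "D \<subseteq> A"
  shows "coeff (kraw_gen (card D) (card A - card D)) i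
    = (\<Sum>S | S \<subseteq> A \<and> card S = i. \<Prod>a\<in>S. if a \<in> D then -1 else 1)"
  using assms by (simp add: kraw_gen_eq_prod coeff_prod_linear)

section \<open>Coefficients of the generating polynomial and their recurrence\<close>

lemma coeff_linear_power_binomial:
  fixes c :: "'a :: comm_ring_1"
  shows "coeff ([:1, c:] ^ n) i = of_nat (n choose i) * c ^ i"
proof (cases "i \<le> n")
  case True
  then show ?thesis by (simp add: coeff_linear_poly_power)
next
  case False
  have "degree ([:1, c:] ^ n) \<le> 1 * n"
    by (rule order.trans[OF degree_power_le]) simp
  with False show ?thesis by (simp add: coeff_eq_0 binomial_eq_0)
qed

lemma coeff_kraw_gen: "coeff (kraw_gen m r) k = krawtchouk_K (m + r) k (real m)"
  unfolding kraw_gen_def krawtchouk_K_def coeff_mult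
  by (intro sum.cong refl) (simp add: coeff_linear_power_binomial binomial_gbinomial)

text \<open>Multiplying by the linear factor restores the exponent \<open>m\<close>, so the case
  \<open>m = 0\<close> is included.\<close>

lemma pderiv_linear_power_mult:
  fixes c :: "'a :: idom"
  shows "pderiv ([:1, c:] ^ m) * [:1, c:] = smult (of_nat m * c) ([:1, c:] ^ m)"
proof (cases m)
  case (Suc l)
  have "smult a q * [:c:] * p = smult (a * c) (p * q)" for a and p q :: "'a poly"
    by (simp add: mult.commute)
  moreover have "pderiv [:1, c:] = [:c:]" by (simp add: pderiv_pCons)
  ultimately show ?thesis unfolding Suc pderiv_power_Suc by (simp only: power_Suc)
qed simp

text \<open>The logarithmic derivative is \<open>r / (1 + X) - m / (1 - X)\<close>, here cleared of
  denominators by \<open>1 - X^2\<close>. Comparing coefficients then gives a three-term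
  recurrence.\<close>

lemma kraw_gen_deriv:
  "pderiv (kraw_gen m r) * [:1, 0, -1:] = kraw_gen m r * [:real r - real m, - real (m + r):]"
proof -
  have A: "pderiv ([:1, -1 :: real:] ^ m) * [:1, -1:] = smult (- real m) ([:1, -1:] ^ m)"
    using pderiv_linear_power_mult[of "-1 :: real" m] by simp
  have B: "pderiv ([:1, 1 :: real:] ^ r) * [:1, 1:] = smult (real r) ([:1, 1:] ^ r)"
    using pderiv_linear_power_mult[of "1 :: real" r] by simp
  have "[:1, 0, -1 :: real:] = [:1, -1:] * [:1, 1:]" by simp
  hence "pderiv (kraw_gen m r) * [:1, 0, -1:]
     = [:1, -1:] ^ m * [:1, -1:] * (pderiv ([:1, 1 :: real:] ^ r) * [:1, 1:])
       + [:1, 1:] ^ r * [:1, 1:] * (pderiv ([:1, -1 :: real:] ^ m) * [:1, -1:])"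
    by (simp add: kraw_gen_def pderiv_mult algebra_simps del: mult_pCons_left mult_pCons_right)
  also have "\<dots> = kraw_gen m r * (smult (real r) [:1, -1:] + smult (- real m) [:1, 1:])"
    by (simp only: A B kraw_gen_def mult_smult_left mult_smult_right distrib_left) (simp only: ac_simps)
  also have "smult (real r) [:1, -1:] + smult (- real m) [:1, 1:]
      = [:real r - real m, - real (m + r):]"
    by simp
  finally show ?thesis .
qed

lemma coeff_kraw_gen_0: "coeff (kraw_gen m r) 0 = 1"
  by (simp add: coeff_kraw_gen krawtchouk_K_def)

lemma coeff_kraw_gen_1: "coeff (kraw_gen m r) (Suc 0) = real r - real m"
  by (simp add: coeff_kraw_gen krawtchouk_K_def)

lemma coeff_kraw_gen_rec:
  "real (i + 2) * coeff (kraw_gen m r) (i + 2)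
    = (real r - real m) * coeff (kraw_gen m r) (i + 1)
      - (real (m + r) - real i) * coeff (kraw_gen m r) i"
proof -
  have "coeff (pderiv (kraw_gen m r) * [:1, 0, -1:]) (i + 1)
      = real (i + 2) * coeff (kraw_gen m r) (i + 2) - real i * coeff (kraw_gen m r) i"
    by (cases i) (simp_all add: coeff_pderiv coeff_pCons mult.commute[of _ "[:_, _, _:]"])
  moreover have "coeff (kraw_gen m r * [:real r - real m, - real (m + r):]) (i + 1)
      = (real r - real m) * coeff (kraw_gen m r) (i + 1)
        - real (m + r) * coeff (kraw_gen m r) i"
    by (simp add: coeff_pCons mult.commute[of _ "[:_, _:]"] algebra_simps)
  ultimately show ?thesis
    by (simp only: kraw_gen_deriv left_diff_distrib)
qed

text \<open>The binomial factor turns the normalised \<open>Q\<close> into the usual Krawtchouk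
  values; both sides satisfy the same recurrence with the same initial values. The bound
  \<open>i \<le> n\<close> keeps the divisors in the recursion nonzero.\<close>

lemma krawtchouk_Q_eq_coeff:
  assumes "m + r = n" and "n \<ge> 1" and "i \<le> n"
  shows "real (n choose i) * krawtchouk_Q n i (1 - 2 * real m / real n) = coeff (kraw_gen m r) i"
  using assms(3)
proof (induction i rule: induct_nat_012)
  case 0
  then show ?case by (simp add: coeff_kraw_gen_0)
next
  case 1
  then show ?case using assms by (auto simp: coeff_kraw_gen_1 field_simps)
next
  case (ge2 i)
  define t where "t = 1 - 2 * real m / real n"
  have nt: "real n * t = real r - real m"
    using assms by (auto simp: t_def field_simps)
  have choose: "real (Suc j) * real (n choose Suc j) = (real n - real j) * real (n choose j)"
    if "j \<le> n" for j
    using binomial_absorb_comp[of n j] Suc_times_binomial_eq[of "n - 1" j] that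
    by (metis mult.commute of_nat_diff of_nat_mult binomial_absorption)
  have "real (i + 2) * (real (n choose Suc (Suc i)) * krawtchouk_Q n (Suc (Suc i)) t)
      = real (n choose Suc i) * ((real n - real (Suc i)) * krawtchouk_Q n (Suc (Suc i)) t)"
    using choose[of "Suc i"] ge2.prems
    by (simp only: mult.assoc[symmetric] numeral_2_eq_2 add_Suc_right add_0_right) (simp only: ac_simps)
  also have "(real n - real (Suc i)) * krawtchouk_Q n (Suc (Suc i)) t
      = (real r - real m) * krawtchouk_Q n (Suc i) t - real (Suc i) * krawtchouk_Q n i t"
    using ge2.prems by (simp add: nt)
  also have "real (n choose Suc i) * \<dots>
      = (real r - real m) * (real (n choose Suc i) * krawtchouk_Q n (Suc i) t)
        - real (Suc i) * real (n choose Suc i) * krawtchouk_Q n i t"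
    by (simp add: algebra_simps)
  also have "\<dots> = (real r - real m) * (real (n choose Suc i) * krawtchouk_Q n (Suc i) t)
        - (real n - real i) * (real (n choose i) * krawtchouk_Q n i t)"
    using choose[of i] ge2.prems by simp
  also have "\<dots> = real (i + 2) * coeff (kraw_gen m r) (i + 2)"
    using ge2 coeff_kraw_gen_rec[of i m r] by (simp add: t_def flip: assms(1))
  finally show ?case by (simp add: t_def del: krawtchouk_Q.simps)
qed

text \<open>Multiplication by \<open>1 - X\<close> takes differences of coefficients, so partial
  sums undo it and lower \<open>m\<close> by one. This produces the shifts \<open>n - 2\<close> and
  \<open>z - 1\<close> of the adjacent polynomial.\<close>

lemma sum_coeff_kraw_gen:
  "(\<Sum>i\<le>k. coeff (kraw_gen (Suc m) r) i) = coeff (kraw_gen m r) k"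
proof -
  have "kraw_gen (Suc m) r = kraw_gen m r * [:1, -1:]"
    by (simp only: kraw_gen_def power_Suc ac_simps)
  then show ?thesis
    by (induction k) (simp_all add: coeff_pCons mult.commute[of _ "[:_, _:]"])
qed


section \<open>Characters and moments\<close>

definition bit_sign :: "bit \<Rightarrow> real" where
  "bit_sign b = (if b = 0 then 1 else -1)"

lemma bit_sign_mult: "bit_sign a * bit_sign b = (if a = b then 1 else -1)"
  by (cases a; cases b) (simp_all add: bit_sign_def)

definition chi :: "nat set \<Rightarrow> bit list \<Rightarrow> real" where
  "chi S x = (\<Prod>i\<in>S. bit_sign (x ! i))"

lemma finite_F2: "finite (F2 n)"
proof -
  have "UNIV = {0, 1 :: bit}" by (auto simp: bit_not_one_iff)
  then have "finite (UNIV :: bit set)" by (metis finite.emptyI finite.insertI)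
  from finite_lists_length_eq[OF this, of n] show ?thesis by (simp add: F2_def)
qed

lemma chi_mult_chi: "chi S x * chi S y = (\<Prod>i\<in>S. if x ! i \<noteq> y ! i then -1 else 1)"
  unfolding chi_def prod.distrib[symmetric] bit_sign_mult by (intro prod.cong) auto

text \<open>The addition formula expands \<open>Q\<close> at \<open>ip n x y\<close> into products
  \<open>chi S x * chi S y\<close>, so the double sum over \<open>C\<close> factors into squares.
  Their nonnegativity lets one vanishing moment kill each character sum separately.\<close>

lemma moment_eq_sum_squares:
  assumes "C \<subseteq> F2 n" and "n \<ge> 1" and "i \<le> n"
  shows "real (n choose i) * moment n i C
    = (\<Sum>S | S \<subseteq> {..<n} \<and> card S = i. (\<Sum>x\<in>C. chi S x)\<^sup>2)"
proof -
  have eq: "real (n choose i) * krawtchouk_Q n i (ip n x y)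
      = (\<Sum>S | S \<subseteq> {..<n} \<and> card S = i. chi S x * chi S y)" if "x \<in> C" for x y
  proof -
    define D where "D = {j. j < n \<and> x ! j \<noteq> y ! j}"
    have "length x = n" using that assms by (auto simp: F2_def)
    then have ip: "ip n x y = 1 - 2 * real (card D) / real n"
      by (simp add: ip_def hamming_def D_def)
    have D: "D \<subseteq> {..<n}" by (auto simp: D_def)
    then have "card D \<le> n" using card_mono[OF _ D] by simp
    then have "real (n choose i) * krawtchouk_Q n i (ip n x y)
        = coeff (kraw_gen (card D) (n - card D)) i"
      using assms by (simp only: ip) (rule krawtchouk_Q_eq_coeff; simp)
    also have "\<dots> = (\<Sum>S | S \<subseteq> {..<n} \<and> card S = i. \<Prod>j\<in>S. if j \<in> D then -1 else 1)"
      using coeff_kraw_gen_eq_sum[OF _ D] by simp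
    also have "\<dots> = (\<Sum>S | S \<subseteq> {..<n} \<and> card S = i. chi S x * chi S y)"
      unfolding chi_mult_chi D_def by (intro sum.cong prod.cong refl) auto
    finally show ?thesis .
  qed
  have "real (n choose i) * moment n i C
      = (\<Sum>x\<in>C. \<Sum>y\<in>C. \<Sum>S | S \<subseteq> {..<n} \<and> card S = i. chi S x * chi S y)"
    unfolding moment_def sum_distrib_left by (intro sum.cong refl eq)
  also have "\<dots> = (\<Sum>x\<in>C. \<Sum>S | S \<subseteq> {..<n} \<and> card S = i. \<Sum>y\<in>C. chi S x * chi S y)"
    by (intro sum.cong refl) (rule sum.swap)
  also have "\<dots> = (\<Sum>S | S \<subseteq> {..<n} \<and> card S = i. \<Sum>x\<in>C. \<Sum>y\<in>C. chi S x * chi S y)"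
    by (rule sum.swap)
  finally show ?thesis by (simp add: power2_eq_square sum_product)
qed

lemma kk_design_sum_chi:
  assumes "kk_design n k C" and "2 * k \<le> n"
    and "S \<subseteq> {..<n}" and "S \<noteq> {}" and "even (card S)" and "card S \<le> 2 * k"
  shows "(\<Sum>x\<in>C. chi S x) = 0"
proof -
  have "finite S" using assms(3) finite_subset by blast
  then have "card S \<noteq> 0" using assms(4) by simp
  with assms(5,6) obtain j where j: "card S = 2 * j" "j \<in> {1..k}" by (auto elim!: evenE)
  have "n \<ge> 1" using assms(3,4) by (cases n) auto
  have "(\<Sum>T | T \<subseteq> {..<n} \<and> card T = 2 * j. (\<Sum>x\<in>C. chi T x)\<^sup>2) = 0"
    using moment_eq_sum_squares[of C n "2 * j"] j assms(1,2) \<open>n \<ge> 1\<close> by (auto simp: kk_design_def)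
  moreover have "finite {T. T \<subseteq> {..<n} \<and> card T = 2 * j}" by simp
  ultimately have "(\<Sum>x\<in>C. chi T x)\<^sup>2 = 0" if "T \<subseteq> {..<n}" "card T = 2 * j" for T
    using that by (simp add: sum_nonneg_eq_0_iff)
  with j assms(3) show ?thesis by auto
qed

section \<open>Existence of designs\<close>

lemma sum_chi_F2:
  assumes "S \<subseteq> {..<n}" and "S \<noteq> {}"
  shows "(\<Sum>x\<in>F2 n. chi S x) = 0"
proof -
  obtain s where s: "s \<in> S" "s < n" using assms by auto
  have fin: "finite S" using assms finite_subset by blast
  define flip where "flip x = x[s := if x ! s = 0 then 1 else 0 :: bit]" for x
  have flip: "flip x \<in> F2 n" "flip (flip x) = x" "chi S (flip x) = - chi S x"
    if "x \<in> F2 n" for x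
  proof -
    have len: "length x = n" using that by (simp add: F2_def)
    then show "flip x \<in> F2 n" by (simp add: flip_def F2_def)
    show "flip (flip x) = x"
      using s len by (cases "x ! s") (auto simp: flip_def list_update_same_conv)
    have "chi (S - {s}) (flip x) = chi (S - {s}) x"
      unfolding chi_def flip_def by (intro prod.cong) auto
    moreover have "bit_sign (flip x ! s) = - bit_sign (x ! s)"
      using s len by (simp add: flip_def bit_sign_def)
    ultimately show "chi S (flip x) = - chi S x"
      unfolding chi_def using fin s by (simp add: prod.remove[of S s])
  qed
  have "(\<Sum>x\<in>F2 n. chi S x) = (\<Sum>x\<in>F2 n. - chi S x)"
    by (rule sum.reindex_bij_witness[of _ flip flip]) (auto simp: flip)
  then show ?thesis by (simp add: sum_negf)
qed

text \<open>Ensures that the infimum in \<open>min_design_card\<close> is attained by a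
  design.\<close>

lemma kk_design_F2:
  assumes "n \<ge> 1" and "2 * k \<le> n"
  shows "kk_design n k (F2 n)"
  unfolding kk_design_def
proof (intro conjI ballI)
  show "F2 n \<noteq> {}" using Ex_list_of_length[of n] by (auto simp: F2_def)
  fix j assume j: "j \<in> {1..k}"
  have "real (n choose (2 * j)) * moment n (2 * j) (F2 n)
      = (\<Sum>S | S \<subseteq> {..<n} \<and> card S = 2 * j. (\<Sum>x\<in>F2 n. chi S x)\<^sup>2)"
    using assms j by (intro moment_eq_sum_squares) auto
  also have "\<dots> = 0"
  proof (intro sum.neutral ballI)
    fix S assume "S \<in> {S. S \<subseteq> {..<n} \<and> card S = 2 * j}"
    with j show "(\<Sum>x\<in>F2 n. chi S x)\<^sup>2 = 0" by (subst sum_chi_F2) auto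
  qed
  finally show "moment n (2 * j) (F2 n) = 0" using assms j by simp
qed simp

section \<open>Designs as orthogonal arrays of strength \<open>2k\<close>\<close>

text \<open>The word \<open>x\<close> is replaced by the word of its differences with its own coordinate \<open>c\<close>, i.e. by
  its class modulo the all-one word; \<open>psi c S\<close> are the characters of the quotient.\<close>

definition psi :: "nat \<Rightarrow> nat set \<Rightarrow> bit list \<Rightarrow> real" where
  "psi c S x = (\<Prod>i\<in>S. bit_sign (x ! i) * bit_sign (x ! c))"

lemma psi_square: "psi c S x * psi c S x = 1"
  unfolding psi_def prod.distrib[symmetric] by (intro prod.neutral) (simp add: bit_sign_mult)

text \<open>Common factors occur squared and cancel.\<close>

lemma prod_mult_prod_sym_diff:
  fixes f :: "'a \<Rightarrow> 'b :: comm_monoid_mult"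
  assumes "finite S" and "finite T" and "\<And>a. f a * f a = 1"
  shows "prod f S * prod f T = prod f ((S - T) \<union> (T - S))"
proof -
  have "prod f (S \<inter> T) * prod f (S \<inter> T) = 1"
    unfolding prod.distrib[symmetric] using assms by simp
  then have one: "a * prod f (S \<inter> T) * prod f (S \<inter> T) = a" for a
    by (simp add: mult.assoc)
  have "prod f S * prod f T
      = prod f (S \<inter> T) * prod f (S - T) * (prod f (T \<inter> S) * prod f (T - S))"
    using assms by (simp flip: prod.Int_Diff)
  also have "\<dots> = prod f (S - T) * prod f (T - S) * prod f (S \<inter> T) * prod f (S \<inter> T)"
    by (simp add: Int_commute ac_simps)
  also have "\<dots> = prod f (S - T) * prod f (T - S)"
    by (rule one)
  also have "\<dots> = prod f ((S - T) \<union> (T - S))"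
    using assms by (intro prod.union_disjoint[symmetric]) auto
  finally show ?thesis .
qed

text \<open>\<open>psi c V\<close> is the character \<open>chi\<close> of whichever of
  \<open>V\<close> and \<open>insert c V\<close> has even size, so the even moments also control odd
  \<open>V\<close>.\<close>

lemma kk_design_sum_psi:
  assumes "kk_design n k C" and "2 * k \<le> n" and "c < n"
    and "V \<subseteq> {..<n} - {c}" and "V \<noteq> {}" and "card V \<le> 2 * k"
  shows "(\<Sum>x\<in>C. psi c V x) = 0"
proof -
  have V: "finite V" "c \<notin> V" using assms(4) finite_subset by auto
  define W where "W = (if even (card V) then V else insert c V)"
  have "psi c V x = chi W x" for x
  proof -
    have "psi c V x = chi V x * bit_sign (x ! c) ^ card V"
      by (simp add: psi_def chi_def prod.distrib)
    also have "\<dots> = chi W x"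
      using V by (cases "x ! c") (auto simp: W_def chi_def bit_sign_def)
    finally show ?thesis .
  qed
  moreover have "(\<Sum>x\<in>C. chi W x) = 0"
  proof (rule kk_design_sum_chi[OF assms(1,2)])
    show "even (card W)" using V by (simp add: W_def)
    \<comment> \<open>Inserting \<open>c\<close> is only bounded crudely here; parity brings the
      size back to \<open>2 * k\<close>.\<close>
    moreover have "card W \<le> Suc (2 * k)" using V assms(6) by (simp add: W_def)
    ultimately show "card W \<le> 2 * k" by (metis le_Suc_eq even_Suc even_mult_iff even_numeral)
  qed (use assms in \<open>auto simp: W_def\<close>)
  ultimately show ?thesis by simp
qed

text \<open>The product is the character of the symmetric difference, which is nonempty of size at
  most \<open>2 * k\<close>. This halving of the strength puts sets of size at most \<open>k\<close>
  into the bound.\<close>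

lemma kk_design_psi_orthogonal:
  assumes "kk_design n k C" and "2 * k \<le> n" and "c < n"
    and "S \<subseteq> {..<n} - {c}" and "card S \<le> k" and "T \<subseteq> {..<n} - {c}" and "card T \<le> k" and "S \<noteq> T"
  shows "(\<Sum>x\<in>C. psi c S x * psi c T x) = 0"
proof -
  have fin: "finite S" "finite T" using assms(4,6) by (auto intro: finite_subset)
  have "psi c S x * psi c T x = psi c ((S - T) \<union> (T - S)) x" for x
    unfolding psi_def by (rule prod_mult_prod_sym_diff[OF fin]) (simp add: bit_sign_mult)
  moreover have "(\<Sum>x\<in>C. psi c ((S - T) \<union> (T - S)) x) = 0"
  proof (rule kk_design_sum_psi[OF assms(1-3)])
    have "card ((S - T) \<union> (T - S)) \<le> card (S \<union> T)" using fin by (intro card_mono) auto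
    also have "\<dots> \<le> card S + card T" by (rule card_Un_le)
    finally show "card ((S - T) \<union> (T - S)) \<le> 2 * k" using assms(5,7) by simp
  qed (use assms in auto)
  ultimately show ?thesis by simp
qed

lemma kk_design_finite: "kk_design n k C \<Longrightarrow> finite C"
  using finite_F2 finite_subset by (auto simp: kk_design_def)

text \<open>Counting the \<open>x \<in> C\<close> whose coordinates in \<open>V\<close> all agree with the coordinate \<open>c\<close>.\<close>

lemma kk_design_card_dvd:
  assumes "kk_design n k C" and "2 * k \<le> n" and "c < n"
    and "V \<subseteq> {..<n} - {c}" and "card V \<le> 2 * k"
  shows "2 ^ card V dvd card C"
proof -
  have V: "finite V" using assms(4) finite_subset by blast
  have C: "finite C" using assms(1) by (rule kk_design_finite)
  define P where "P x \<longleftrightarrow> (\<forall>i\<in>V. x ! i = x ! c)" for x :: "bit list"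
  \<comment> \<open>This product is a multiple of the indicator of \<open>P\<close>, and expanding
    it gives the sum of \<open>psi c W\<close> over all \<open>W \<subseteq> V\<close>.\<close>
  have prod: "(\<Prod>i\<in>V. bit_sign (x ! i) * bit_sign (x ! c) + 1) = (if P x then 2 ^ card V else 0)" for x
  proof (cases "P x")
    case True
    then have "(\<Prod>i\<in>V. bit_sign (x ! i) * bit_sign (x ! c) + 1) = (\<Prod>i\<in>V. 2)"
      by (intro prod.cong) (auto simp: P_def bit_sign_mult)
    with True show ?thesis by simp
  next
    case False
    with V show ?thesis by (auto simp: P_def bit_sign_mult intro!: prod_zero)
  qed
  \<comment> \<open>Only the empty set has a nonzero character sum.\<close>
  have "real (card C) = (\<Sum>W\<in>{{}}. \<Sum>x\<in>C. psi c W x)"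
    by (simp add: psi_def)
  also have "\<dots> = (\<Sum>W\<in>Pow V. \<Sum>x\<in>C. psi c W x)"
  proof (intro sum.mono_neutral_left ballI)
    fix W assume W: "W \<in> Pow V - {{}}"
    then have "card W \<le> card V" using V by (intro card_mono) auto
    with W assms show "(\<Sum>x\<in>C. psi c W x) = 0" by (intro kk_design_sum_psi) auto
  qed (use V in auto)
  also have "\<dots> = (\<Sum>x\<in>C. \<Sum>W\<in>Pow V. psi c W x)" by (rule sum.swap)
  also have "\<dots> = (\<Sum>x\<in>C. if P x then 2 ^ card V else 0)"
    unfolding prod[symmetric] prod_add[OF V] by (simp add: psi_def)
  also have "\<dots> = real (2 ^ card V * card {x \<in> C. P x})"
    using C by (simp add: sum.If_cases Int_def)
  finally have "card C = 2 ^ card V * card {x \<in> C. P x}" by (simp only: of_nat_eq_iff)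
  then show ?thesis by simp
qed

section \<open>The bound and its equality case\<close>

text \<open>A Parseval identity: after expanding the square, orthogonality leaves only the terms
  \<open>u = v\<close>.\<close>

lemma orthogonal_kernel_square_sum:
  fixes \<phi> :: "'u \<Rightarrow> 'x \<Rightarrow> real"
  assumes "finite U" and "\<And>u x. u \<in> U \<Longrightarrow> \<phi> u x * \<phi> u x = 1"
    and orth: "\<And>u v. u \<in> U \<Longrightarrow> v \<in> U \<Longrightarrow> u \<noteq> v \<Longrightarrow> (\<Sum>x\<in>C. \<phi> u x * \<phi> v x) = 0"
  shows "(\<Sum>y\<in>C. (\<Sum>u\<in>U. \<phi> u x * \<phi> u y)\<^sup>2) = real (card U) * real (card C)"
proof -
  have "(\<Sum>y\<in>C. (\<Sum>u\<in>U. \<phi> u x * \<phi> u y)\<^sup>2)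
      = (\<Sum>y\<in>C. \<Sum>u\<in>U. \<Sum>v\<in>U. \<phi> u x * \<phi> v x * (\<phi> u y * \<phi> v y))"
    unfolding power2_eq_square sum_product by (intro sum.cong refl) (simp add: ac_simps)
  also have "\<dots> = (\<Sum>u\<in>U. \<Sum>y\<in>C. \<Sum>v\<in>U. \<phi> u x * \<phi> v x * (\<phi> u y * \<phi> v y))"
    by (rule sum.swap)
  also have "\<dots> = (\<Sum>u\<in>U. \<Sum>v\<in>U. \<phi> u x * \<phi> v x * (\<Sum>y\<in>C. \<phi> u y * \<phi> v y))"
    unfolding sum_distrib_left by (intro sum.cong refl) (rule sum.swap)
  also have "\<dots> = (\<Sum>u\<in>U. \<Sum>v\<in>U. if u = v then real (card C) else 0)"
    using assms by (intro sum.cong refl) auto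
  finally show ?thesis using assms(1) by simp
qed

text \<open>The term \<open>y = x\<close> alone contributes \<open>(card U)^2\<close> to the total
  \<open>card U * card C\<close>. The other squares sum to
  \<open>card U * (card C - card U)\<close>, which gives the inequality and, in case of equality,
  their vanishing.\<close>

lemma orthogonal_signs_card_le:
  fixes \<phi> :: "'u \<Rightarrow> 'x \<Rightarrow> real"
  assumes "finite U" and "finite C" and "C \<noteq> {}"
    and sq: "\<And>u x. u \<in> U \<Longrightarrow> \<phi> u x * \<phi> u x = 1"
    and orth: "\<And>u v. u \<in> U \<Longrightarrow> v \<in> U \<Longrightarrow> u \<noteq> v \<Longrightarrow> (\<Sum>x\<in>C. \<phi> u x * \<phi> v x) = 0"
  shows "card U \<le> card C"
    and "card U = card C \<Longrightarrow> x \<in> C \<Longrightarrow> y \<in> C \<Longrightarrow> x \<noteq> y \<Longrightarrow> (\<Sum>u\<in>U. \<phi> u x * \<phi> u y) = 0"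
proof -
  define R where "R x y = (\<Sum>u\<in>U. \<phi> u x * \<phi> u y)" for x y
  have diag: "R x x = real (card U)" for x
    unfolding R_def using sq by simp
  have total: "(\<Sum>y\<in>C - {x}. (R x y)\<^sup>2) = real (card U) * (real (card C) - real (card U))"
    if "x \<in> C" for x
  proof -
    have "(R x x)\<^sup>2 + (\<Sum>y\<in>C - {x}. (R x y)\<^sup>2) = (\<Sum>y\<in>C. (R x y)\<^sup>2)"
      by (rule sum.remove[OF assms(2) that, symmetric])
    also have "\<dots> = real (card U) * real (card C)"
      unfolding R_def by (rule orthogonal_kernel_square_sum) (use assms(1) sq orth in auto)
    finally have "(R x x)\<^sup>2 + (\<Sum>y\<in>C - {x}. (R x y)\<^sup>2) = real (card U) * real (card C)" .
    then show ?thesis by (simp add: diag power2_eq_square algebra_simps)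
  qed
  show "card U \<le> card C"
  proof -
    obtain x where "x \<in> C" using assms(3) by blast
    then have "0 \<le> real (card U) * (real (card C) - real (card U))"
      by (simp flip: total add: sum_nonneg)
    then show ?thesis by (cases "card U = 0") (auto simp: zero_le_mult_iff)
  qed
  show "(\<Sum>u\<in>U. \<phi> u x * \<phi> u y) = 0"
    if "card U = card C" "x \<in> C" "y \<in> C" "x \<noteq> y"
  proof -
    have "(\<Sum>y\<in>C - {x}. (R x y)\<^sup>2) = 0" using that by (simp add: total)
    then have "\<forall>y\<in>C - {x}. (R x y)\<^sup>2 = 0"
      using assms(2) by (subst (asm) sum_nonneg_eq_0_iff) auto
    with that show ?thesis by (simp add: R_def)
  qed
qed

section \<open>Rao's bound for designs and its equality case\<close>

lemma sum_subsets_card_le: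
  fixes f :: "'a set \<Rightarrow> 'b :: comm_monoid_add"
  assumes "finite A"
  shows "(\<Sum>S | S \<subseteq> A \<and> card S \<le> k. f S) = (\<Sum>i\<le>k. \<Sum>S | S \<subseteq> A \<and> card S = i. f S)"
proof -
  have "(\<Sum>i\<le>k. \<Sum>S | S \<in> {S. S \<subseteq> A \<and> card S \<le> k} \<and> card S = i. f S)
      = (\<Sum>S | S \<subseteq> A \<and> card S \<le> k. f S)"
    using assms by (intro sum.group) auto
  moreover have "{S \<in> {S. S \<subseteq> A \<and> card S \<le> k}. card S = i} = {S. S \<subseteq> A \<and> card S = i}"
    if "i \<le> k" for i
    using that by auto
  ultimately show ?thesis by simp
qed

lemma card_subsets_card_le:
  assumes "finite A"
  shows "card {S. S \<subseteq> A \<and> card S \<le> k} = (\<Sum>i\<le>k. card A choose i)"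
  using sum_subsets_card_le[OF assms, of "\<lambda>_. 1 :: nat" k] n_subsets[OF assms] by simp

text \<open>The index family consists of the small sets among the \<open>n - 1\<close> coordinates
  other than \<open>c\<close>. The coordinate \<open>c\<close> stays arbitrary because the equality
  case picks it according to \<open>x\<close> and \<open>y\<close>.\<close>

lemma kk_design_card_ge:
  assumes "kk_design n k C" and "2 * k \<le> n" and "c < n"
  shows "(\<Sum>i\<le>k. (n - 1) choose i) \<le> card C"
    and "card C = (\<Sum>i\<le>k. (n - 1) choose i) \<Longrightarrow> x \<in> C \<Longrightarrow> y \<in> C \<Longrightarrow> x \<noteq> y \<Longrightarrow>
      (\<Sum>S | S \<subseteq> {..<n} - {c} \<and> card S \<le> k. psi c S x * psi c S y) = 0"
proof -
  let ?U = "{S. S \<subseteq> {..<n} - {c} \<and> card S \<le> k}"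
  have card: "card ?U = (\<Sum>i\<le>k. (n - 1) choose i)"
    using card_subsets_card_le[of "{..<n} - {c}" k] assms(3) by simp
  note bound = orthogonal_signs_card_le[of ?U C "psi c", OF _ kk_design_finite[OF assms(1)]]
  have C: "C \<noteq> {}" using assms(1) by (simp add: kk_design_def)
  show "(\<Sum>i\<le>k. (n - 1) choose i) \<le> card C"
    unfolding card[symmetric]
    by (rule bound(1)) (use C assms in \<open>auto simp: psi_square intro: kk_design_psi_orthogonal\<close>)
  show "(\<Sum>S\<in>?U. psi c S x * psi c S y) = 0"
    if "card C = (\<Sum>i\<le>k. (n - 1) choose i)" "x \<in> C" "y \<in> C" "x \<noteq> y"
    by (rule bound(2)) (use C that card assms in \<open>auto simp: psi_square intro: kk_design_psi_orthogonal\<close>)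
qed

text \<open>If \<open>x\<close> and \<open>y\<close> agree at \<open>c\<close>, the negative signs
  sit exactly at the differing coordinates. The vanishing kernel is then a partial sum of Krawtchouk
  values of length \<open>n - 1\<close> at the distance, which collapses to a single value of length
  \<open>n - 2\<close>.\<close>

lemma kk_design_tight_zero:
  assumes "kk_design n k C" and "2 * k \<le> n" and "card C = (\<Sum>i\<le>k. (n - 1) choose i)"
    and "x \<in> C" and "y \<in> C" and "x \<noteq> y"
  shows "krawtchouk_K (n - 2) k (real (hamming x y) - 1) = 0"
proof -
  have len: "length x = n" "length y = n" using assms(1,4,5) by (auto simp: kk_design_def F2_def)
  have kernel: "(\<Sum>S | S \<subseteq> {..<n} - {c} \<and> card S \<le> k.
      \<Prod>i\<in>S. if (x ! i \<noteq> y ! i) \<noteq> (x ! c \<noteq> y ! c) then -1 else 1 :: real) = 0" if "c < n" for c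
  proof -
    have "psi c S x * psi c S y
        = (\<Prod>i\<in>S. if (x ! i \<noteq> y ! i) \<noteq> (x ! c \<noteq> y ! c) then -1 else 1)" for S
      unfolding psi_def prod.distrib[symmetric]
      by (intro prod.cong refl, cases "x ! c"; cases "y ! c") (simp_all add: bit_sign_def)
    with kk_design_card_ge(2)[OF assms(1,2) that assms(3-6)] show ?thesis by simp
  qed
  define D where "D = {i. i < n \<and> x ! i \<noteq> y ! i}"
  have D: "card D = hamming x y" by (simp add: D_def hamming_def len)
  have "D \<noteq> {}" using assms(6) len by (auto simp: D_def intro: nth_equalityI)
  then obtain m where m: "card D = Suc m"
    by (metis D_def card_0_eq finite_Collect_conjI finite_Collect_less_nat not0_implies_Suc)
  \<comment> \<open>Complementary words have the same class modulo the all-one word, so every term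
    of their kernel would be 1 and the kernel could not vanish.\<close>
  have "\<exists>c<n. x ! c = y ! c"
  proof (rule ccontr)
    assume differ: "\<not> (\<exists>c<n. x ! c = y ! c)"
    have "0 < n" using \<open>D \<noteq> {}\<close> by (auto simp: D_def)
    let ?U = "{S. S \<subseteq> {..<n} - {0} \<and> card S \<le> k}"
    have "(\<Sum>S\<in>?U. \<Prod>i\<in>S. if (x ! i \<noteq> y ! i) \<noteq> (x ! 0 \<noteq> y ! 0) then -1 else 1 :: real) = (\<Sum>S\<in>?U. 1)"
      using differ \<open>0 < n\<close> by (intro sum.cong prod.neutral refl) auto
    moreover have "{} \<in> ?U" "finite ?U" by auto
    ultimately show False using kernel[OF \<open>0 < n\<close>] by (auto simp: card_eq_0_iff)
  qed
  then obtain c where c: "c < n" "x ! c = y ! c" by blast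
  let ?A = "{..<n} - {c}"
  have DA: "D \<subseteq> ?A" using c by (auto simp: D_def)
  have cardA: "card ?A = n - 1" using c by simp
  have "Suc m \<le> n - 1" using card_mono[OF _ DA] m cardA by simp
  have "0 = (\<Sum>S | S \<subseteq> ?A \<and> card S \<le> k. \<Prod>i\<in>S. if i \<in> D then -1 else 1 :: real)"
    unfolding kernel[OF c(1), symmetric] using c
    by (intro sum.cong prod.cong refl) (auto simp: D_def)
  also have "\<dots> = (\<Sum>i\<le>k. coeff (kraw_gen (Suc m) (n - 1 - Suc m)) i)"
    using coeff_kraw_gen_eq_sum[OF _ DA] by (simp add: sum_subsets_card_le cardA m)
  also have "\<dots> = krawtchouk_K (m + (n - 1 - Suc m)) k (real m)"
    unfolding sum_coeff_kraw_gen by (rule coeff_kraw_gen)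
  also have "m + (n - 1 - Suc m) = n - 2" using \<open>Suc m \<le> n - 1\<close> by simp
  finally show ?thesis using m by (simp flip: D)
qed

text \<open>Serves to exclude tight designs with \<open>n = 2 * k\<close> and
  \<open>k + 2 \<le> n\<close>, whose positive cardinality would be a multiple of
  \<open>2 ^ (n - 1)\<close>.\<close>

lemma sum_binomial_less_two_power:
  assumes "k < m"
  shows "(\<Sum>i\<le>k. m choose i) < 2 ^ m"
proof -
  have "(\<Sum>i\<le>k. m choose i) < (\<Sum>i\<le>m. m choose i)"
    using assms by (intro sum_strict_mono2[of _ _ m]) auto
  then show ?thesis by (simp add: choose_row_sum)
qed

theorem theorem4p1:
  fixes n k :: nat
  assumes "n \<ge> 1" and "k \<ge> 1" and "real k \<le> real n / 2"
  shows "min_design_card n k \<ge> (\<Sum>i\<le>k. (n - 1) choose i) \<and>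
    (\<forall>C. kk_design n k C \<and> card C = (\<Sum>i\<le>k. (n - 1) choose i) \<longrightarrow>
       (\<forall>x\<in>C. \<forall>y\<in>C. x \<noteq> y \<longrightarrow> adjacent_Q11 n k (ip n x y) = 0) \<and>
       (k + 2 \<le> n \<longrightarrow> 2 ^ (2 * k) dvd card C))"
proof (intro conjI allI impI ballI)
  have kn: "2 * k \<le> n" using assms(3) by linarith
  have "{card C |C. kk_design n k C} \<noteq> {}" using kk_design_F2[OF assms(1) kn] by blast
  from Inf_nat_def1[OF this] obtain C where "kk_design n k C" "min_design_card n k = card C"
    unfolding min_design_card_def by blast
  then show "(\<Sum>i\<le>k. (n - 1) choose i) \<le> min_design_card n k"
    using kk_design_card_ge(1)[of n k C 0] kn assms(1) by simp
  fix C assume "kk_design n k C \<and> card C = (\<Sum>i\<le>k. (n - 1) choose i)"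
  then have C: "kk_design n k C" "card C = (\<Sum>i\<le>k. (n - 1) choose i)" by auto
  show "adjacent_Q11 n k (ip n x y) = 0" if "x \<in> C" "y \<in> C" "x \<noteq> y" for x y
  proof -
    have "real n * (1 - ip n x y) / 2 = real (hamming x y)"
      using assms(1) by (simp add: ip_def)
    with kk_design_tight_zero[OF C(1) kn C(2) that] show ?thesis by (simp add: adjacent_Q11_def)
  qed
  assume k2: "k + 2 \<le> n"
  show "2 ^ (2 * k) dvd card C"
  proof (cases "2 * k \<le> n - 1")
    case True
    then obtain V where "V \<subseteq> {..<n} - {0}" "card V = 2 * k"
      using obtain_subset_with_card_n[of "2 * k" "{..<n} - {0}"] assms(1) by auto
    with kk_design_card_dvd[OF C(1) kn, of 0 V] assms(1) show ?thesis by simp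
  next
    \<comment> \<open>Here \<open>n = 2k\<close>, and a tight design cannot exist.\<close>
    case False
    have "2 ^ (n - 1) dvd card C"
      using kk_design_card_dvd[OF C(1) kn, of 0 "{..<n} - {0}"] kn assms(1) False by simp
    \<comment> \<open>From \<open>k + 2 \<le> n\<close> comes \<open>k < n - 1\<close>. This
      excludes \<open>n = 2\<close>, \<open>k = 1\<close>, where a tight design with two elements
      exists.\<close>
    moreover have "card C < 2 ^ (n - 1)"
      unfolding C(2) using k2 by (intro sum_binomial_less_two_power) simp
    moreover have "0 < card C"
      using C(1) kk_design_finite[OF C(1)] by (auto simp: kk_design_def card_gt_0_iff)
    ultimately show ?thesis using dvd_imp_le by fastforce
  qed
qed

end
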